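(* Let $p,q$ be positive integers and let $x=(x(N))_{N\ge0}$ be a fixed point of a $p$-$q$-block substitution. Let $r$ be a positive integer. Then the sequence $y=(x(rN))_{N\ge0}$ is the image under a coding of a fixed point of some $p$-$q$-block substitution.
   Context: A $p$-$q$-block substitution $\sigma$ on an alphabet $A$ assigns to each word of length $p$ over $A$ a word of length $q$ over $A$; it acts on an infinite sequence $x=x_0x_1\dots$ by $\sigma(x)=z$ where $z_{qk}\dots z_{q(k+1)-1}=\sigma(x_{pk}\dots x_{p(k+1)-1})$ for $k\ge0$. A fixed point of $\sigma$ is a sequence $x$ with $\sigma(x)=x$. A coding is a letter-to-letter map from one alphabet to another, applied letterwise to sequences. *)

theory Defs
  imports Main
begin

definition words :: "nat \<Rightarrow> 'a set \<Rightarrow> 'a list set" where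
  "words n A = {w. length w = n \<and> set w \<subseteq> A}"

(* Values of \<sigma> outside words p A are irrelevant. *)
definition block_subst :: "nat \<Rightarrow> nat \<Rightarrow> 'a set \<Rightarrow> ('a list \<Rightarrow> 'a list) \<Rightarrow> bool" where
  "block_subst p q A \<sigma> \<longleftrightarrow> (\<forall>w \<in> words p A. \<sigma> w \<in> words q A)"

(* For q > 0, position n = q * k + j with j < q receives the j-th letter of the image of
   the k-th block of length p; see block_subst_apply_blocks. *)
definition block_subst_apply ::
  "nat \<Rightarrow> nat \<Rightarrow> ('a list \<Rightarrow> 'a list) \<Rightarrow> (nat \<Rightarrow> 'a) \<Rightarrow> (nat \<Rightarrow> 'a)" where
  "block_subst_apply p q \<sigma> x =
     (\<lambda>n. \<sigma> (map x [p * (n div q) ..< p * (n div q + 1)]) ! (n mod q))"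

lemma block_subst_apply_blocks:
  assumes "0 < q" "block_subst p q A \<sigma>" "range x \<subseteq> A"
  shows "block_subst_apply p q \<sigma> x = z \<longleftrightarrow>
    (\<forall>k. map z [q * k ..< q * (k + 1)] = \<sigma> (map x [p * k ..< p * (k + 1)]))"
proof -
  have len: "length (\<sigma> (map x [p * k ..< p * (k + 1)])) = q" for k
  proof -
    have "map x [p * k ..< p * (k + 1)] \<in> words p A"
      using assms(3) by (auto simp: words_def)
    then show ?thesis
      using assms(2) by (auto simp: block_subst_def words_def)
  qed
  show ?thesis
  proof
    assume z: "block_subst_apply p q \<sigma> x = z"
    show "\<forall>k. map z [q * k ..< q * (k + 1)] = \<sigma> (map x [p * k ..< p * (k + 1)])"
    proof
      fix k
      show "map z [q * k ..< q * (k + 1)] = \<sigma> (map x [p * k ..< p * (k + 1)])"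
        using assms(1) len[of k] z[symmetric]
        by (intro nth_equalityI) (simp_all add: block_subst_apply_def)
    qed
  next
    assume *: "\<forall>k. map z [q * k ..< q * (k + 1)] = \<sigma> (map x [p * k ..< p * (k + 1)])"
    show "block_subst_apply p q \<sigma> x = z"
    proof
      fix n
      have "block_subst_apply p q \<sigma> x n
          = map z [q * (n div q) ..< q * (n div q + 1)] ! (n mod q)"
        using * by (simp add: block_subst_apply_def)
      also have "\<dots> = z n"
      proof -
        have "q * (n div q) + n mod q < q * (n div q + 1)"
          using mod_less_divisor[OF assms(1), of n] by (simp only: distrib_left mult_1_right add_less_cancel_left)
        from nth_upt[OF this] show ?thesis
          using assms(1) by simp
      qed
      finally show "block_subst_apply p q \<sigma> x n = z n" .
    qed
  qed
qed

definition block_subst_fixed_point ::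
  "nat \<Rightarrow> nat \<Rightarrow> 'a set \<Rightarrow> ('a list \<Rightarrow> 'a list) \<Rightarrow> (nat \<Rightarrow> 'a) \<Rightarrow> bool" where
  "block_subst_fixed_point p q A \<sigma> x \<longleftrightarrow>
     range x \<subseteq> A \<and> block_subst_apply p q \<sigma> x = x"

definition coding :: "'b set \<Rightarrow> 'a set \<Rightarrow> ('b \<Rightarrow> 'a) \<Rightarrow> bool" where
  "coding B A \<tau> \<longleftrightarrow> (\<forall>b \<in> B. \<tau> b \<in> A)"

end

theory Submission
  imports Defs
begin

text \<open>
  Group \<open>x\<close> into consecutive blocks of length \<open>r\<close>. A run of \<open>p\<close> such blocks consists of \<open>r\<close> aligned
  blocks of length \<open>p\<close>, which \<open>\<sigma>\<close> maps to \<open>r\<close> aligned blocks of length \<open>q\<close>, that is, to \<open>q\<close> blocks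
  of length \<open>r\<close>. So the grouped sequence is itself a fixed point of a \<open>p\<close>-\<open>q\<close>-block substitution, and
  taking the first letter of each block is the coding.
\<close>

lemma map_upt_eq_iff:
  "map f [a ..< a + n] = map g [b ..< b + n] \<longleftrightarrow> (\<forall>i<n. f (a + i) = g (b + i))"
  by (auto simp: list_eq_iff_nth_eq)

text \<open>By \<open>det\<close>, the q-block at index k depends only on the p-block at index k. So
  the image of a p-block can be copied from any one of its occurrences in \<open>z\<close>.\<close>

lemma ex_block_subst_fixed_point:
  fixes z :: "nat \<Rightarrow> 'b"
  assumes "0 < q"
    and det: "\<And>k k'. map z [p * k ..< p * (k + 1)] = map z [p * k' ..< p * (k' + 1)]
      \<Longrightarrow> map z [q * k ..< q * (k + 1)] = map z [q * k' ..< q * (k' + 1)]"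
  shows "\<exists>\<sigma>. block_subst p q (range z) \<sigma> \<and> block_subst_fixed_point p q (range z) \<sigma> z"
proof -
  \<comment> \<open>If \<open>w\<close> does not occur in \<open>z\<close> at a multiple of
    \<open>p\<close>, then \<open>pos w\<close> is arbitrary, but \<open>\<sigma> w\<close> is still
    a word of length \<open>q\<close> over \<open>range z\<close>.\<close>
  define pos where "pos w = (SOME k. map z [p * k ..< p * (k + 1)] = w)" for w
  define \<sigma> where "\<sigma> w = map z [q * pos w ..< q * (pos w + 1)]" for w
  have subst: "block_subst p q (range z) \<sigma>"
    by (auto simp: block_subst_def words_def \<sigma>_def)
  have "map z [p * pos w ..< p * (pos w + 1)] = w" if "w = map z [p * k ..< p * (k + 1)]" for w k
    unfolding pos_def by (rule someI[of _ k]) (simp only: that)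
  then have "map z [q * k ..< q * (k + 1)] = \<sigma> (map z [p * k ..< p * (k + 1)])" for k
    unfolding \<sigma>_def by (intro det) metis
  then have "block_subst_apply p q \<sigma> z = z"
    using block_subst_apply_blocks[OF assms(1) subst] by blast
  with subst show ?thesis
    by (auto simp: block_subst_fixed_point_def)
qed

text \<open>Since \<open>x\<close> is fixed, its r q-blocks from index a on are the images of its r
  p-blocks from index a on, which together form the run of \<open>p * r\<close> letters at
  \<open>p * a\<close>.\<close>

lemma block_subst_apply_cong_run:
  assumes "0 < q" and "block_subst_apply p q \<sigma> x = x"
    and run: "\<And>i. i < p * r \<Longrightarrow> x (p * a + i) = x (p * b + i)"
    and "j < q * r"
  shows "x (q * a + j) = x (q * b + j)"
proof -
  define m where "m = j div q"
  have "m < r"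
    using assms(1,4) by (simp add: m_def less_mult_imp_div_less mult.commute)
  \<comment> \<open>Position \<open>q * c + j\<close> falls in q-block \<open>c + m\<close>, at
    offset \<open>j mod q\<close>.\<close>
  have val: "x (q * c + j) = \<sigma> (map x [p * (c + m) ..< p * (c + m) + p]) ! (j mod q)" for c
    using fun_cong[OF assms(2), of "q * c + j"] assms(1)
    by (simp add: block_subst_apply_def m_def add.commute)
  have "x (p * (a + m) + i) = x (p * (b + m) + i)" if "i < p" for i
  proof -
    have "p * m + i < p * (m + 1)"
      using that by simp
    also have "\<dots> \<le> p * r"
      using \<open>m < r\<close> by (intro mult_le_mono2) simp
    finally show ?thesis
      using run[of "p * m + i"] by (simp add: distrib_left add.assoc)
  qed
  then have "map x [p * (a + m) ..< p * (a + m) + p] = map x [p * (b + m) ..< p * (b + m) + p]"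
    unfolding map_upt_eq_iff by blast
  then show ?thesis
    by (simp only: val)
qed

text \<open>Injectivity of \<open>f\<close> lets n consecutive codes determine n * r consecutive
  letters of \<open>x\<close>. The start is written \<open>n * (r * k)\<close> to fit
  \<open>block_subst_apply_cong_run\<close> with a = r * k, both for n = p and for n = q.\<close>

lemma grouped_run_eq_iff:
  fixes f :: "'a list \<Rightarrow> 'b"
  assumes "0 < r" and "inj_on f (words r A)" and "range x \<subseteq> A"
    and z: "\<And>N. z N = f (map x [r * N ..< r * N + r])"
  shows "map z [n * k ..< n * (k + 1)] = map z [n * k' ..< n * (k' + 1)] \<longleftrightarrow>
    (\<forall>i < n * r. x (n * (r * k) + i) = x (n * (r * k') + i))"
proof -
  have "map x [r * N ..< r * N + r] \<in> words r A" for N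
    using assms(3) by (auto simp: words_def)
  then have z_eq: "z M = z N \<longleftrightarrow> (\<forall>j<r. x (r * M + j) = x (r * N + j))" for M N
    unfolding z using inj_on_eq_iff[OF assms(2)] by (simp add: map_upt_eq_iff)
  have "map z [n * k ..< n * (k + 1)] = map z [n * k' ..< n * (k' + 1)] \<longleftrightarrow>
      (\<forall>i<n. \<forall>j<r. x (r * (n * k + i) + j) = x (r * (n * k' + i) + j))"
    using map_upt_eq_iff[of z "n * k" n z "n * k'"] by (simp add: z_eq add.commute)
  also have "\<dots> \<longleftrightarrow> (\<forall>i < n * r. x (n * (r * k) + i) = x (n * (r * k') + i))"
  proof (intro iffI allI impI)
    fix i
    assume "\<forall>i<n. \<forall>j<r. x (r * (n * k + i) + j) = x (r * (n * k' + i) + j)" and "i < n * r"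
    \<comment> \<open>Letter i of the run is letter \<open>i mod r\<close> of its r-block
      \<open>i div r\<close>.\<close>
    then have "x (r * (n * k + i div r) + i mod r) = x (r * (n * k' + i div r) + i mod r)"
      using assms(1) by (simp add: less_mult_imp_div_less)
    then show "x (n * (r * k) + i) = x (n * (r * k') + i)"
      by (simp add: distrib_left add.assoc mult.left_commute)
  next
    fix i j
    assume *: "\<forall>i < n * r. x (n * (r * k) + i) = x (n * (r * k') + i)" and "i < n" "j < r"
    have "r * i + j < r * (i + 1)"
      using \<open>j < r\<close> by simp
    also have "\<dots> \<le> r * n"
      using \<open>i < n\<close> by (intro mult_le_mono2) simp
    finally have "r * i + j < n * r"
      by (simp add: mult.commute)
    with * show "x (r * (n * k + i) + j) = x (r * (n * k' + i) + j)"
      by (simp add: distrib_left add.assoc mult.left_commute)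
  qed
  finally show ?thesis .
qed

theorem theorem11:
  fixes p q r :: nat
    and A :: "'a set"
    and \<sigma> :: "'a list \<Rightarrow> 'a list"
    and x :: "nat \<Rightarrow> 'a"
  assumes "0 < p" and "0 < q" and "0 < r"
    and "finite A"
    and "block_subst p q A \<sigma>"
    and "block_subst_fixed_point p q A \<sigma> x"
  shows "\<exists>(B :: nat set) (\<sigma>' :: nat list \<Rightarrow> nat list) (z :: nat \<Rightarrow> nat) (\<tau> :: nat \<Rightarrow> 'a).
           finite B \<and> block_subst p q B \<sigma>' \<and> block_subst_fixed_point p q B \<sigma>' z \<and>
           coding B A \<tau> \<and> (\<lambda>N. x (r * N)) = \<tau> \<circ> z"
proof -
  have x: "range x \<subseteq> A" "block_subst_apply p q \<sigma> x = x"
    using assms(6) by (auto simp: block_subst_fixed_point_def)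
  have fin: "finite (words r A)"
    using finite_lists_length_eq[OF assms(4), of r] by (simp add: words_def conj_commute)
  \<comment> \<open>The new alphabet consists of naturals, so \<open>f\<close> numbers the finitely
    many words of length r.\<close>
  then obtain f :: "'a list \<Rightarrow> nat" where f: "inj_on f (words r A)"
    using finite_imp_inj_to_nat_seg by blast
  define z where "z N = f (map x [r * N ..< r * N + r])" for N
  define \<tau> where "\<tau> b = hd (the_inv_into (words r A) f b)" for b
  have block: "map x [r * N ..< r * N + r] \<in> words r A" for N
    using x(1) by (auto simp: words_def)
  \<comment> \<open>As r > 0, the decoded block is nonempty and starts with
    \<open>x (r * N)\<close>.\<close>
  have "\<tau> (z N) = x (r * N)" for N
    using assms(3) by (simp add: \<tau>_def z_def the_inv_into_f_f[OF f block] hd_map)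
  then have coding: "coding (range z) A \<tau>" "(\<lambda>N. x (r * N)) = \<tau> \<circ> z"
    using x(1) by (auto simp: coding_def)
  have "finite (range z)"
    by (rule finite_subset[OF _ finite_imageI[OF fin, of f]]) (use block in \<open>auto simp: z_def\<close>)
  moreover have "\<exists>\<sigma>'. block_subst p q (range z) \<sigma>' \<and> block_subst_fixed_point p q (range z) \<sigma>' z"
  proof (rule ex_block_subst_fixed_point[OF assms(2)])
    note run = grouped_run_eq_iff[OF assms(3) f x(1) z_def]
    fix k k'
    assume "map z [p * k ..< p * (k + 1)] = map z [p * k' ..< p * (k' + 1)]"
    then show "map z [q * k ..< q * (k + 1)] = map z [q * k' ..< q * (k' + 1)]"
      \<comment> \<open>\<open>run\<close> is used with n = p in the assumption and n = q in the
        goal.\<close>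
      unfolding run using block_subst_apply_cong_run[OF assms(2) x(2)] by blast
  qed
  ultimately show ?thesis
    using coding by blast
qed

end
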